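(* For $\rho\in\mathcal{P}_+(G)$ and $i,j,k\in\{1,\dots,n\}$ let $$\begin{aligned}\Gamma_{ij}^{W,k}=\frac14\sum_{k'\in N(k)}\omega_{kk'}\Big\{&-(L^\dagger_{ki}-L^\dagger_{k'i})(\delta_{jk}+\delta_{jk'})-(L^\dagger_{kj}-L^\dagger_{k'j})(\delta_{ik}+\delta_{ik'})\\&+\theta_{kk'}\sum_{k''\in N(k)}\omega_{kk''}(L^\dagger_{ki}-L^\dagger_{k''i})(L^\dagger_{kj}-L^\dagger_{k''j})\\&-\theta_{kk'}\sum_{k'''\in N(k')}\omega_{k'k'''}(L^\dagger_{k'i}-L^\dagger_{k'''i})(L^\dagger_{k'j}-L^\dagger_{k'''j})\Big\}.\end{aligned}$$ Then the Levi-Civita connection $\nabla^W$ of $(\mathcal{P}_+(G),g_W)$ satisfies, for all $\sigma_1,\sigma_2\in T_\rho\mathcal{P}_+(G)$ (regarded as constant vector fields) and all $k$, $$\sum_{1\le i,j\le n}\Gamma^{W,k}_{ij}\,\sigma_1(i)\sigma_2(j)=(\nabla^W_{\sigma_1}\sigma_2)(k).$$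
   Context: $G=(V,E,\omega)$ is a connected, weighted, undirected finite graph with vertex set $V=\{1,\dots,n\}$, edge set $E$ and weights $\omega_{ij}=\omega_{ji}>0$ if $(i,j)\in E$, $\omega_{ij}=0$ otherwise; $N(i)=\{j:(i,j)\in E\}$. For $a\in\mathbb{R}^n$ put $\theta_{ij}(a)=\frac{a_i+a_j}{2}$, and $\theta_{ij}=\theta_{ij}(\rho)$; the linear weighted Laplacian matrix $L(a)\in\mathbb{R}^{n\times n}$ is given by $(L(a)\Phi)(i)=\sum_{j\in N(i)}\omega_{ij}\theta_{ij}(a)(\Phi(i)-\Phi(j))$. $L(\rho)^\dagger=(L^\dagger_{ij})_{1\le i,j\le n}$ is its Moore-Penrose pseudo-inverse at $\rho$, and $\delta_{ij}$ is the Kronecker delta. $\mathcal{P}_+(G)=\{\rho\in\mathbb{R}^n:\sum_i\rho_i=1,\ \rho_i>0\}$, with tangent space $T_\rho\mathcal{P}_+(G)=\{\sigma\in\mathbb{R}^n:\sum_i\sigma_i=0\}$, carries the Riemannian metric $g_W(\sigma_1,\sigma_2)=\sigma_1^{\mathsf T}L(\rho)^\dagger\sigma_2$. *)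

theory Defs
  imports "HOL-Analysis.Analysis"
begin

section \<open>Affine connections on an open piece of an affine subspace\<close>

text \<open>
  Throughout, \<open>M\<close> stands for a relatively open subset of a translate of the linear subspace \<open>T\<close>;
  it is a manifold with a single (affine) chart, whose tangent space at every point is \<open>T\<close>.
  Tensor fields on \<open>M\<close> are total functions of which only the values on \<open>M\<close> matter.
\<close>

text \<open>Only meaningful for \<open>p \<in> M\<close> and \<open>v \<in> T\<close>, in which case \<open>p + t v \<in> M\<close> for small \<open>t\<close>.\<close>

definition dir_deriv :: "('a::real_normed_vector \<Rightarrow> 'b::real_normed_vector) \<Rightarrow> 'a \<Rightarrow> 'a \<Rightarrow> 'b" where
  "dir_deriv f p v = vector_derivative (\<lambda>t. f (p + t *\<^sub>R v)) (at 0)"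

text \<open>
  \<open>m\<close>-fold continuous differentiability. As \<open>differentiable_on\<close> refers to the filter
  \<open>at x within M\<close>, only increments tangent to \<open>M\<close> enter.
\<close>

fun C_on ::
  "nat \<Rightarrow> 'a::real_normed_vector set \<Rightarrow> 'a set \<Rightarrow> ('a \<Rightarrow> 'b::real_normed_vector) \<Rightarrow> bool" where
  "C_on 0 M T f \<longleftrightarrow> continuous_on M f"
| "C_on (Suc m) M T f \<longleftrightarrow>
     f differentiable_on M \<and> (\<forall>v\<in>T. C_on m M T (\<lambda>x. dir_deriv f x v))"

definition smooth_on ::
  "'a::real_normed_vector set \<Rightarrow> 'a set \<Rightarrow> ('a \<Rightarrow> 'b::real_normed_vector) \<Rightarrow> bool" where
  "smooth_on M T f \<longleftrightarrow> (\<forall>m. C_on m M T f)"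

definition vector_fields ::
  "'a::real_normed_vector set \<Rightarrow> 'a set \<Rightarrow> ('a \<Rightarrow> 'a) set" where
  "vector_fields M T = {X. smooth_on M T X \<and> (\<forall>x\<in>M. X x \<in> T)}"

text \<open>The Lie bracket in the affine chart, \<open>[X, Y] = DY \<cdot> X - DX \<cdot> Y\<close>.\<close>

definition lie_bracket ::
  "('a::real_normed_vector \<Rightarrow> 'a) \<Rightarrow> ('a \<Rightarrow> 'a) \<Rightarrow> 'a \<Rightarrow> 'a" where
  "lie_bracket X Y p = dir_deriv Y p (X p) - dir_deriv X p (Y p)"

text \<open>
  That \<open>nabla X Y\<close> on \<open>M\<close> depends only on the values of \<open>X\<close> and \<open>Y\<close> on \<open>M\<close> is a consequence of
  the axioms: take for \<open>f\<close> the indicator function of the complement of \<open>M\<close>.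
\<close>

definition affine_connection ::
  "'a::real_normed_vector set \<Rightarrow> 'a set \<Rightarrow> (('a \<Rightarrow> 'a) \<Rightarrow> ('a \<Rightarrow> 'a) \<Rightarrow> 'a \<Rightarrow> 'a) \<Rightarrow> bool" where
  "affine_connection M T nabla \<longleftrightarrow>
     (\<forall>X\<in>vector_fields M T. \<forall>Y\<in>vector_fields M T. nabla X Y \<in> vector_fields M T) \<and>
     (\<forall>X\<in>vector_fields M T. \<forall>X'\<in>vector_fields M T. \<forall>Y\<in>vector_fields M T. \<forall>p\<in>M.
        nabla (\<lambda>x. X x + X' x) Y p = nabla X Y p + nabla X' Y p) \<and>
     (\<forall>f::'a \<Rightarrow> real. smooth_on M T f \<longrightarrow>
        (\<forall>X\<in>vector_fields M T. \<forall>Y\<in>vector_fields M T. \<forall>p\<in>M.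
           nabla (\<lambda>x. f x *\<^sub>R X x) Y p = f p *\<^sub>R nabla X Y p)) \<and>
     (\<forall>X\<in>vector_fields M T. \<forall>Y\<in>vector_fields M T. \<forall>Y'\<in>vector_fields M T. \<forall>p\<in>M.
        nabla X (\<lambda>x. Y x + Y' x) p = nabla X Y p + nabla X Y' p) \<and>
     (\<forall>f::'a \<Rightarrow> real. smooth_on M T f \<longrightarrow>
        (\<forall>X\<in>vector_fields M T. \<forall>Y\<in>vector_fields M T. \<forall>p\<in>M.
           nabla X (\<lambda>x. f x *\<^sub>R Y x) p
             = dir_deriv f p (X p) *\<^sub>R Y p + f p *\<^sub>R nabla X Y p))"

definition torsion_free ::
  "'a::real_normed_vector set \<Rightarrow> 'a set \<Rightarrow> (('a \<Rightarrow> 'a) \<Rightarrow> ('a \<Rightarrow> 'a) \<Rightarrow> 'a \<Rightarrow> 'a) \<Rightarrow> bool" where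
  "torsion_free M T nabla \<longleftrightarrow>
     (\<forall>X\<in>vector_fields M T. \<forall>Y\<in>vector_fields M T. \<forall>p\<in>M.
        nabla X Y p - nabla Y X p = lie_bracket X Y p)"

definition metric_compatible ::
  "'a::real_normed_vector set \<Rightarrow> 'a set \<Rightarrow> ('a \<Rightarrow> 'a \<Rightarrow> 'a \<Rightarrow> real)
     \<Rightarrow> (('a \<Rightarrow> 'a) \<Rightarrow> ('a \<Rightarrow> 'a) \<Rightarrow> 'a \<Rightarrow> 'a) \<Rightarrow> bool" where
  "metric_compatible M T g nabla \<longleftrightarrow>
     (\<forall>X\<in>vector_fields M T. \<forall>Y\<in>vector_fields M T. \<forall>Z\<in>vector_fields M T. \<forall>p\<in>M.
        dir_deriv (\<lambda>x. g x (Y x) (Z x)) p (X p)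
          = g p (nabla X Y p) (Z p) + g p (Y p) (nabla X Z p))"

definition levi_civita_connection ::
  "'a::real_normed_vector set \<Rightarrow> 'a set \<Rightarrow> ('a \<Rightarrow> 'a \<Rightarrow> 'a \<Rightarrow> real)
     \<Rightarrow> (('a \<Rightarrow> 'a) \<Rightarrow> ('a \<Rightarrow> 'a) \<Rightarrow> 'a \<Rightarrow> 'a) \<Rightarrow> bool" where
  "levi_civita_connection M T g nabla \<longleftrightarrow>
     affine_connection M T nabla \<and> torsion_free M T nabla \<and> metric_compatible M T g nabla"


section \<open>The Moore-Penrose pseudo-inverse\<close>

definition is_moore_penrose :: "real^'n^'m \<Rightarrow> real^'m^'n \<Rightarrow> bool" where
  "is_moore_penrose A B \<longleftrightarrow>
     A ** B ** A = A \<and> B ** A ** B = B \<and>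
     transpose (A ** B) = A ** B \<and> transpose (B ** A) = B ** A"

definition pinv :: "real^'n^'m \<Rightarrow> real^'m^'n" where
  "pinv A = (THE B. is_moore_penrose A B)"


section \<open>Weighted graphs and the Wasserstein metric on the open probability simplex\<close>

text \<open>The vertex set is the whole index type \<open>'n\<close>.\<close>

definition connected_weighted_graph :: "('n::finite \<times> 'n) set \<Rightarrow> ('n \<Rightarrow> 'n \<Rightarrow> real) \<Rightarrow> bool" where
  "connected_weighted_graph E \<omega> \<longleftrightarrow>
     sym E \<and> (\<forall>i j. (i, j) \<in> E\<^sup>*) \<and>
     (\<forall>i j. \<omega> i j = \<omega> j i) \<and>
     (\<forall>i j. if (i, j) \<in> E then \<omega> i j > 0 else \<omega> i j = 0)"

definition neighbours :: "('n \<times> 'n) set \<Rightarrow> 'n \<Rightarrow> 'n set" where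
  "neighbours E i = {j. (i, j) \<in> E}"

definition \<theta> :: "real^'n \<Rightarrow> 'n \<Rightarrow> 'n \<Rightarrow> real" where
  "\<theta> a i j = (a $ i + a $ j) / 2"

definition wlaplacian ::
  "('n::finite \<times> 'n) set \<Rightarrow> ('n \<Rightarrow> 'n \<Rightarrow> real) \<Rightarrow> real^'n \<Rightarrow> real^'n^'n" where
  "wlaplacian E \<omega> a =
     matrix (\<lambda>\<Phi>. \<chi> i. \<Sum>j\<in>neighbours E i. \<omega> i j * \<theta> a i j * (\<Phi> $ i - \<Phi> $ j))"

definition prob_simplex :: "(real^'n::finite) set" where
  "prob_simplex = {\<rho>. (\<Sum>i\<in>UNIV. \<rho> $ i) = 1 \<and> (\<forall>i. \<rho> $ i > 0)}"

definition tangent_simplex :: "(real^'n::finite) set" where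
  "tangent_simplex = {\<sigma>. (\<Sum>i\<in>UNIV. \<sigma> $ i) = 0}"

definition wasserstein_metric ::
  "('n::finite \<times> 'n) set \<Rightarrow> ('n \<Rightarrow> 'n \<Rightarrow> real) \<Rightarrow> real^'n \<Rightarrow> real^'n \<Rightarrow> real^'n \<Rightarrow> real" where
  "wasserstein_metric E \<omega> \<rho> \<sigma>1 \<sigma>2 = \<sigma>1 \<bullet> (pinv (wlaplacian E \<omega> \<rho>) *v \<sigma>2)"

definition kronecker :: "'n \<Rightarrow> 'n \<Rightarrow> real" where
  "kronecker i j = (if i = j then 1 else 0)"

definition christoffel_W ::
  "('n::finite \<times> 'n) set \<Rightarrow> ('n \<Rightarrow> 'n \<Rightarrow> real) \<Rightarrow> real^'n \<Rightarrow> 'n \<Rightarrow> 'n \<Rightarrow> 'n \<Rightarrow> real" where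
  "christoffel_W E \<omega> \<rho> k i j =
     (let P = pinv (wlaplacian E \<omega> \<rho>) in
      1/4 * (\<Sum>k'\<in>neighbours E k. \<omega> k k' *
        (- (P $ k $ i - P $ k' $ i) * (kronecker j k + kronecker j k')
         - (P $ k $ j - P $ k' $ j) * (kronecker i k + kronecker i k')
         + \<theta> \<rho> k k' * (\<Sum>k''\<in>neighbours E k.
             \<omega> k k'' * (P $ k $ i - P $ k'' $ i) * (P $ k $ j - P $ k'' $ j))
         - \<theta> \<rho> k k' * (\<Sum>k'''\<in>neighbours E k'.
             \<omega> k' k''' * (P $ k' $ i - P $ k''' $ i) * (P $ k' $ j - P $ k''' $ j)))))"

end

theory Submission
  imports Defs
begin

text \<open>
  Write \<open>P = L(\<rho>)\<^sup>\<dagger>\<close>, \<open>\<phi> = P \<sigma>\<^sub>1\<close> and \<open>\<psi> = P \<sigma>\<^sub>2\<close>. Constant vector fields commute, so the Koszul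
  formula determines \<open>u = \<nabla>\<^bsub>\<sigma>\<^sub>1\<^esub> \<sigma>\<^sub>2\<close> through the derivatives of the metric coefficients:
  \<open>2 g(u, c) = \<sigma>\<^sub>1 g(\<sigma>\<^sub>2, c) + \<sigma>\<^sub>2 g(\<sigma>\<^sub>1, c) - c g(\<sigma>\<^sub>1, \<sigma>\<^sub>2)\<close> for every tangent \<open>c\<close>.

  The simplex is open in its affine hull and connectedness makes the kernel of \<open>L(\<rho>)\<close> the
  constants at each of its points. Hence \<open>L(\<rho>) P = P L(\<rho>)\<close> is the projection onto the
  tangent space (\<open>pinv_constant_kernel\<close>), and since the kernel does not move with \<open>\<rho>\<close>, the
  pseudo-inverse is differentiated like an inverse. As \<open>L\<close> is linear in \<open>\<rho>\<close>, the derivative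
  of \<open>L(\<rho>)\<^sup>\<dagger>\<close> in direction \<open>v\<close> is \<open>- P L(v) P\<close> (\<open>dir_deriv_wasserstein_metric\<close>). The Koszul formula becomes
  \<open>2 u \<bullet> P c = - \<psi> \<bullet> L(\<sigma>\<^sub>1) P c - \<phi> \<bullet> L(\<sigma>\<^sub>2) P c + \<phi> \<bullet> L(c) \<psi>\<close>.

  Averaging the density over the two ends of an edge has a dual description: \<open>\<phi> \<bullet> L(c) \<psi>\<close> is the
  pairing of \<open>c\<close> with the carre du champ \<open>B\<close> of \<open>\<phi>\<close> and \<open>\<psi>\<close>
  (\<open>inner_wlaplacian_eq_carre_du_champ\<close>). Putting \<open>c = L(\<rho>) w\<close> with \<open>w\<close> arbitrary therefore
  solves for \<open>u\<close>: \<open>2 u = L(\<rho>) B - L(\<sigma>\<^sub>1) \<psi> - L(\<sigma>\<^sub>2) \<phi>\<close> (\<open>wasserstein_connection_eq\<close>). The same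
  vector, halved, comes out when the Christoffel symbols are contracted with \<open>\<sigma>\<^sub>1\<close> and \<open>\<sigma>\<^sub>2\<close>
  (\<open>sum_christoffel_W\<close>): the Kronecker deltas produce the two terms with a minus sign, and the
  two inner sums are \<open>2 B\<close> at the two ends of the edge.
\<close>

section \<open>Pseudo-inverses of symmetric matrices whose kernel is the constants\<close>

lemma matrix_add_rdistrib: "(A + B) ** C = A ** C + B ** (C :: real^'p::finite^'n::finite)"
  by (simp add: matrix_matrix_mult_def vec_eq_iff sum.distrib distrib_right)

lemma matrix_diff_ldistrib: "A ** (B - C) = A ** B - A ** (C :: real^'p::finite^'n::finite)"
  by (simp add: matrix_matrix_mult_def vec_eq_iff sum_subtractf right_diff_distrib)

lemma matrix_diff_rdistrib: "(A - B) ** C = A ** C - B ** (C :: real^'p::finite^'n::finite)"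
  by (simp add: matrix_matrix_mult_def vec_eq_iff sum_subtractf left_diff_distrib)

lemma transpose_add: "transpose (A + B) = transpose A + transpose (B :: real^'n^'m)"
  by (simp add: transpose_def vec_eq_iff)

lemma transpose_diff: "transpose (A - B) = transpose A - transpose (B :: real^'n^'m)"
  by (simp add: transpose_def vec_eq_iff)

lemma moore_penrose_unique:
  fixes A :: "real^'n^'m"
  assumes "is_moore_penrose A B" and "is_moore_penrose A C"
  shows "B = C"
proof -
  have B: "A ** B ** A = A" "B ** A ** B = B" "transpose (A ** B) = A ** B" "transpose (B ** A) = B ** A"
    and C: "A ** C ** A = A" "C ** A ** C = C" "transpose (A ** C) = A ** C" "transpose (C ** A) = C ** A"
    using assms by (auto simp: is_moore_penrose_def)
  have "A ** B = transpose (A ** C ** A ** B)"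
    using B(3) C(1) by simp
  also have "\<dots> = transpose (A ** B) ** transpose (A ** C)"
    by (metis matrix_mul_assoc matrix_transpose_mul)
  also have "\<dots> = A ** C"
    by (simp add: B C matrix_mul_assoc)
  finally have AB: "A ** B = A ** C" .
  have "B ** A = transpose (B ** (A ** C ** A))"
    using B(4) C(1) by simp
  also have "\<dots> = transpose (C ** A) ** transpose (B ** A)"
    by (metis matrix_mul_assoc matrix_transpose_mul)
  also have "\<dots> = C ** (A ** B ** A)"
    by (simp only: B(4) C(4) matrix_mul_assoc)
  finally have BA: "B ** A = C ** A"
    by (simp add: B)
  have "B = B ** A ** C"
    using AB B(2) by (metis matrix_mul_assoc)
  then show ?thesis
    using BA C(2) by simp
qed

lemma pinv_eqI: "is_moore_penrose A B \<Longrightarrow> pinv A = B"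
  unfolding pinv_def by (blast intro: moore_penrose_unique)

definition mean_matrix :: "real^'n^'n::finite" where
  "mean_matrix = (\<chi> i j. 1 / real CARD('n))"

lemma mean_matrix_mult_vec:
  "mean_matrix *v x = (\<chi> i::'n::finite. (\<Sum>j\<in>UNIV. x $ j) / real CARD('n))"
  by (simp add: mean_matrix_def matrix_vector_mult_def vec_eq_iff sum_divide_distrib)

lemma transpose_mean_matrix: "transpose mean_matrix = mean_matrix"
  by (simp add: mean_matrix_def transpose_def)

lemma mean_matrix_idempotent: "mean_matrix ** mean_matrix = (mean_matrix :: real^'n^'n::finite)"
  by (simp add: mean_matrix_def matrix_matrix_mult_def vec_eq_iff)

text \<open>
  With \<open>J\<close> the orthogonal projection onto the constants, \<open>L + J\<close> is invertible, because \<open>L\<close> and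
  \<open>J\<close> annihilate each other and have no common kernel. Subtracting \<open>J\<close> from its inverse removes the
  part that acts on the constants, and what remains is the pseudo-inverse of \<open>L\<close>.
\<close>

lemma pinv_constant_kernel:
  fixes L :: "real^'n^'n::finite"
  assumes sym: "transpose L = L"
    and ker: "\<And>\<phi>. L *v \<phi> = 0 \<longleftrightarrow> (\<exists>c. \<phi> = (\<chi> i. c))"
  shows "L ** pinv L = mat 1 - mean_matrix" and "pinv L ** L = mat 1 - mean_matrix"
    and "transpose (pinv L) = pinv L"
    and "pinv L ** mean_matrix = 0" and "mean_matrix ** pinv L = 0"
proof -
  define J where "J = (mean_matrix :: real^'n^'n)"
  have JT: "transpose J = J" and JJ: "J ** J = J"
    by (simp_all add: J_def transpose_mean_matrix mean_matrix_idempotent)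
  have "(L ** J) *v x = 0" for x
    unfolding matrix_vector_mul_assoc[symmetric] J_def mean_matrix_mult_vec using ker by blast
  then have LJ: "L ** J = 0"
    by (simp add: matrix_eq)
  have "J ** L = transpose (L ** J)"
    by (simp add: matrix_transpose_mul sym JT)
  then have JL: "J ** L = 0"
    by (simp add: LJ transpose_def zero_vec_def)
  have "x = 0" if x: "(L + J) *v x = 0" for x
  proof -
    have "J *v x = J *v ((L + J) *v x)"
      by (simp add: matrix_vector_mul_assoc matrix_add_ldistrib JL JJ)
    then have Jx: "J *v x = 0"
      using x by simp
    then have "L *v x = 0"
      using x by (simp add: matrix_vector_mult_add_rdistrib)
    then obtain c where "x = (\<chi> i. c)"
      using ker by blast
    with Jx show "x = 0"
      by (simp add: J_def mean_matrix_mult_vec vec_eq_iff)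
  qed
  then have "invertible (L + J)"
    by (simp add: invertible_left_inverse matrix_left_invertible_ker)
  then obtain Q where MQ: "(L + J) ** Q = mat 1" and QM: "Q ** (L + J) = mat 1"
    unfolding invertible_def by blast
  have JQ: "J ** Q = J"
  proof -
    have "J ** Q = (J ** (L + J)) ** Q"
      by (simp add: matrix_add_ldistrib JL JJ)
    then show ?thesis
      using MQ by (simp flip: matrix_mul_assoc)
  qed
  have QJ: "Q ** J = J"
  proof -
    have "Q ** J = Q ** ((L + J) ** J)"
      by (simp add: matrix_add_rdistrib LJ JJ)
    then show ?thesis
      using QM by (simp add: matrix_mul_assoc)
  qed
  have "transpose Q = transpose Q ** ((L + J) ** Q)"
    by (simp add: MQ)
  also have "\<dots> = transpose ((L + J) ** Q) ** Q"
    by (simp add: matrix_transpose_mul matrix_mul_assoc transpose_add sym JT)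
  finally have QT: "transpose Q = Q"
    by (simp add: MQ)
  define P where "P = Q - J"
  have LP: "L ** P = mat 1 - J"
    using MQ by (simp add: P_def matrix_diff_ldistrib matrix_add_rdistrib LJ JQ algebra_simps)
  have PL: "P ** L = mat 1 - J"
    using QM by (simp add: P_def matrix_diff_rdistrib matrix_add_ldistrib JL QJ algebra_simps)
  have PT: "transpose P = P"
    by (simp add: P_def QT JT transpose_diff)
  have PJ: "P ** J = 0" and JP: "J ** P = 0"
    by (simp_all add: P_def matrix_diff_ldistrib matrix_diff_rdistrib JQ QJ JJ)
  have "is_moore_penrose L P"
    unfolding is_moore_penrose_def
    by (simp add: LP PL matrix_diff_rdistrib JL JP transpose_diff JT)
  then have "pinv L = P"
    by (rule pinv_eqI)
  then show "L ** pinv L = mat 1 - mean_matrix" "pinv L ** L = mat 1 - mean_matrix"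
    "transpose (pinv L) = pinv L" "pinv L ** mean_matrix = 0" "mean_matrix ** pinv L = 0"
    using LP PL PT PJ JP by (simp_all add: J_def)
qed

section \<open>The weighted Laplacian\<close>

text \<open>
  The factor one half follows the Bakry-Emery normalisation, which makes this the gradient of
  \<open>a \<mapsto> \<phi> \<bullet> L(a) \<psi>\<close>.
\<close>

definition carre_du_champ ::
  "('n::finite \<Rightarrow> 'n \<Rightarrow> real) \<Rightarrow> real^'n \<Rightarrow> real^'n \<Rightarrow> real^'n" where
  "carre_du_champ \<omega> \<phi> \<psi> =
     (\<chi> i. (\<Sum>j\<in>UNIV. \<omega> i j * (\<phi> $ i - \<phi> $ j) * (\<psi> $ i - \<psi> $ j)) / 2)"

context
  fixes E :: "('n::finite \<times> 'n) set" and \<omega> :: "'n \<Rightarrow> 'n \<Rightarrow> real"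
  assumes graph: "connected_weighted_graph E \<omega>"
begin

lemma \<theta>_commute: "\<theta> a i j = \<theta> a j i"
  by (simp add: \<theta>_def add.commute)

lemma weight_sym: "\<omega> i j = \<omega> j i"
  using graph by (auto simp: connected_weighted_graph_def)

lemma weight_pos: "(i, j) \<in> E \<Longrightarrow> \<omega> i j > 0"
  using graph by (auto simp: connected_weighted_graph_def split: if_splits)

lemma weight_zero: "(i, j) \<notin> E \<Longrightarrow> \<omega> i j = 0"
  using graph by (auto simp: connected_weighted_graph_def split: if_splits)

lemma weight_nonneg: "\<omega> i j \<ge> 0"
  using weight_pos weight_zero by (metis less_eq_real_def)

lemma sum_neighbours: "(\<Sum>j\<in>neighbours E i. \<omega> i j * f j) = (\<Sum>j\<in>UNIV. \<omega> i j * f j)"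
  by (rule sum.mono_neutral_left) (auto simp: neighbours_def weight_zero)

lemma wlaplacian_nth:
  "(wlaplacian E \<omega> a *v \<phi>) $ i = (\<Sum>j\<in>UNIV. \<omega> i j * \<theta> a i j * (\<phi> $ i - \<phi> $ j))"
proof -
  have "linear (\<lambda>\<Phi>::real^'n. \<chi> i. \<Sum>j\<in>neighbours E i. \<omega> i j * \<theta> a i j * (\<Phi> $ i - \<Phi> $ j))"
    by (intro linearI)
      (simp_all add: vec_eq_iff sum.distrib[symmetric] sum_distrib_left algebra_simps)
  then show ?thesis
    by (simp add: wlaplacian_def matrix_works mult.assoc sum_neighbours)
qed

lemma wlaplacian_mult_const [simp]: "wlaplacian E \<omega> a *v (\<chi> i. c) = 0"
  by (simp add: vec_eq_iff wlaplacian_nth)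

lemma wlaplacian_add_scaleR:
  "wlaplacian E \<omega> (a + t *\<^sub>R b) = wlaplacian E \<omega> a + t *\<^sub>R wlaplacian E \<omega> b"
  by (simp add: matrix_eq vec_eq_iff wlaplacian_nth matrix_vector_mult_add_rdistrib
      scaleR_matrix_vector_assoc[symmetric] \<theta>_def sum_distrib_left sum.distrib[symmetric]
      add_divide_distrib algebra_simps)

text \<open>
  Summation by parts: exchanging the ends of each edge and averaging the two expressions.
\<close>

lemma inner_wlaplacian_eq_edge_sum:
  "\<phi> \<bullet> (wlaplacian E \<omega> a *v \<psi>) =
     (\<Sum>i\<in>UNIV. \<Sum>j\<in>UNIV. \<omega> i j * \<theta> a i j * (\<phi> $ i - \<phi> $ j) * (\<psi> $ i - \<psi> $ j)) / 2"
proof -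
  let ?w = "\<lambda>i j. \<omega> i j * \<theta> a i j * (\<psi> $ i - \<psi> $ j)"
  have "\<phi> \<bullet> (wlaplacian E \<omega> a *v \<psi>) = (\<Sum>i\<in>UNIV. \<Sum>j\<in>UNIV. ?w i j * \<phi> $ i)"
    by (simp add: inner_vec_def wlaplacian_nth sum_distrib_left mult_ac)
  moreover have "(\<Sum>i\<in>UNIV. \<Sum>j\<in>UNIV. ?w i j * \<phi> $ i) = (\<Sum>i\<in>UNIV. \<Sum>j\<in>UNIV. - ?w i j * \<phi> $ j)"
    by (subst sum.swap, intro sum.cong refl) (simp add: weight_sym \<theta>_commute algebra_simps)
  ultimately have "2 * (\<phi> \<bullet> (wlaplacian E \<omega> a *v \<psi>)) =
      (\<Sum>i\<in>UNIV. \<Sum>j\<in>UNIV. ?w i j * \<phi> $ i) + (\<Sum>i\<in>UNIV. \<Sum>j\<in>UNIV. - ?w i j * \<phi> $ j)"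
    by simp
  also have "\<dots> = (\<Sum>i\<in>UNIV. \<Sum>j\<in>UNIV. \<omega> i j * \<theta> a i j * (\<phi> $ i - \<phi> $ j) * (\<psi> $ i - \<psi> $ j))"
    unfolding sum.distrib[symmetric] by (intro sum.cong refl) (simp add: algebra_simps)
  finally show ?thesis
    by simp
qed

lemma inner_wlaplacian_commute:
  "\<phi> \<bullet> (wlaplacian E \<omega> a *v \<psi>) = \<psi> \<bullet> (wlaplacian E \<omega> a *v \<phi>)"
  unfolding inner_wlaplacian_eq_edge_sum by (simp add: mult_ac)

lemma transpose_wlaplacian: "transpose (wlaplacian E \<omega> a) = wlaplacian E \<omega> a"
proof -
  have "transpose (wlaplacian E \<omega> a) *v \<phi> = wlaplacian E \<omega> a *v \<phi>" for \<phi>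
    by (rule vector_eq_ldot[THEN iffD1])
      (metis dot_lmul_matrix inner_commute inner_wlaplacian_commute transpose_matrix_vector)
  then show ?thesis
    by (simp add: matrix_eq)
qed

text \<open>
  In \<open>L(a)\<close> an edge carries the mean of \<open>a\<close> at its two ends, so its contribution splits into one
  half for each end, proportional to \<open>a\<close> there. This dualises \<open>a \<mapsto> L(a)\<close> and is what turns the term
  \<open>c g(\<sigma>\<^sub>1, \<sigma>\<^sub>2)\<close> of the Koszul formula into an inner product with \<open>c\<close>.
\<close>

lemma inner_wlaplacian_eq_carre_du_champ:
  "\<phi> \<bullet> (wlaplacian E \<omega> a *v \<psi>) = a \<bullet> carre_du_champ \<omega> \<phi> \<psi>"
proof -
  let ?w = "\<lambda>i j. \<omega> i j * (\<phi> $ i - \<phi> $ j) * (\<psi> $ i - \<psi> $ j)"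
  have "a \<bullet> carre_du_champ \<omega> \<phi> \<psi> = (\<Sum>i\<in>UNIV. \<Sum>j\<in>UNIV. ?w i j * a $ i) / 2"
    by (simp add: inner_vec_def carre_du_champ_def sum_distrib_left sum_divide_distrib mult_ac)
  moreover have "(\<Sum>i\<in>UNIV. \<Sum>j\<in>UNIV. ?w i j * a $ i) = (\<Sum>i\<in>UNIV. \<Sum>j\<in>UNIV. ?w i j * a $ j)"
    by (subst sum.swap, intro sum.cong refl) (simp add: weight_sym algebra_simps)
  ultimately have "a \<bullet> carre_du_champ \<omega> \<phi> \<psi> = ((\<Sum>i\<in>UNIV. \<Sum>j\<in>UNIV. ?w i j * a $ i)
      + (\<Sum>i\<in>UNIV. \<Sum>j\<in>UNIV. ?w i j * a $ j)) / 4"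
    by simp
  also have "\<dots> = (\<Sum>i\<in>UNIV. \<Sum>j\<in>UNIV. \<omega> i j * \<theta> a i j * (\<phi> $ i - \<phi> $ j) * (\<psi> $ i - \<psi> $ j)) / 2"
    unfolding sum.distrib[symmetric] sum_divide_distrib
    by (intro sum.cong refl) (simp add: \<theta>_def field_simps)
  finally show ?thesis
    by (simp add: inner_wlaplacian_eq_edge_sum)
qed

lemma wlaplacian_tangent: "wlaplacian E \<omega> a *v \<phi> \<in> tangent_simplex"
proof -
  have "(\<chi> i. 1) \<bullet> (wlaplacian E \<omega> a *v \<phi>) = 0"
    by (subst inner_wlaplacian_commute) simp
  then show ?thesis
    by (simp add: tangent_simplex_def inner_vec_def)
qed

text \<open>
  The Dirichlet energy of \<open>\<phi>\<close> is a sum of nonnegative edge terms; if it vanishes, \<open>\<phi>\<close> agrees at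
  the ends of every edge, and connectedness spreads this to the whole graph.
\<close>

lemma wlaplacian_kernel:
  assumes \<rho>: "\<And>i. \<rho> $ i > 0"
  shows "wlaplacian E \<omega> \<rho> *v \<phi> = 0 \<longleftrightarrow> (\<exists>c. \<phi> = (\<chi> i. c))"
proof
  assume "wlaplacian E \<omega> \<rho> *v \<phi> = 0"
  then have "(\<Sum>i\<in>UNIV. \<Sum>j\<in>UNIV. \<omega> i j * \<theta> \<rho> i j * (\<phi> $ i - \<phi> $ j) * (\<phi> $ i - \<phi> $ j)) = 0"
    using inner_wlaplacian_eq_edge_sum[of \<phi> \<rho> \<phi>] by simp
  moreover have \<theta>: "\<theta> \<rho> i j > 0" for i j
    using \<rho>[of i] \<rho>[of j] by (simp add: \<theta>_def)
  then have "(\<omega> i j * \<theta> \<rho> i j) * ((\<phi> $ i - \<phi> $ j) * (\<phi> $ i - \<phi> $ j)) \<ge> 0" for i j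
    by (intro mult_nonneg_nonneg zero_le_square weight_nonneg less_imp_le)
  then have "\<omega> i j * \<theta> \<rho> i j * (\<phi> $ i - \<phi> $ j) * (\<phi> $ i - \<phi> $ j) \<ge> 0" for i j
    by (simp only: mult.assoc)
  ultimately have zero: "\<omega> i j * \<theta> \<rho> i j * (\<phi> $ i - \<phi> $ j) * (\<phi> $ i - \<phi> $ j) = 0" for i j
    by (simp add: sum_nonneg_eq_0_iff sum_nonneg)
  have edge: "\<phi> $ i = \<phi> $ j" if "(i, j) \<in> E" for i j
    using zero[of i j] weight_pos[OF that] \<theta>[of i j] by auto
  have "\<phi> $ i = \<phi> $ j" if "(i, j) \<in> E\<^sup>*" for i j
    using that by (induction rule: rtrancl_induct) (auto dest: edge)
  moreover have "(i, j) \<in> E\<^sup>*" for i j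
    using graph by (simp add: connected_weighted_graph_def)
  ultimately have "\<phi> = (\<chi> i. \<phi> $ undefined)"
    unfolding vec_eq_iff by (metis vec_lambda_beta)
  then show "\<exists>c. \<phi> = (\<chi> i. c)" ..
qed auto

section \<open>The pseudo-inverse as a function of the density\<close>

abbreviation green :: "real^'n \<Rightarrow> real^'n^'n" where
  "green x \<equiv> pinv (wlaplacian E \<omega> x)"

lemma green_props:
  assumes "x \<in> prob_simplex"
  shows wlaplacian_green: "wlaplacian E \<omega> x ** green x = mat 1 - mean_matrix"
    and green_wlaplacian: "green x ** wlaplacian E \<omega> x = mat 1 - mean_matrix"
    and transpose_green: "transpose (green x) = green x"
    and green_mean: "green x ** mean_matrix = 0"
    and mean_green: "mean_matrix ** green x = 0"
  using assms pinv_constant_kernel[OF transpose_wlaplacian wlaplacian_kernel, of x]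
  by (simp_all add: prob_simplex_def)

lemma green_symmetric:
  assumes "x \<in> prob_simplex"
  shows "\<phi> \<bullet> (green x *v \<psi>) = \<psi> \<bullet> (green x *v \<phi>)"
  by (metis assms dot_lmul_matrix inner_commute transpose_green transpose_matrix_vector)

text \<open>
  The resolvent identity of true inverses survives because \<open>L(x)\<close> and \<open>L(y)\<close> have the same kernel,
  so that both products \<open>L(x) L(x)\<^sup>\<dagger>\<close> and \<open>L(y)\<^sup>\<dagger> L(y)\<close> are the same projection, which the
  pseudo-inverses absorb.
\<close>

lemma green_resolvent:
  assumes "x \<in> prob_simplex" and "y \<in> prob_simplex"
  shows "green y - green x = green y ** (wlaplacian E \<omega> x - wlaplacian E \<omega> y) ** green x"
proof -
  have "green y ** (wlaplacian E \<omega> x - wlaplacian E \<omega> y) ** green x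
      = green y ** (wlaplacian E \<omega> x ** green x) - (green y ** wlaplacian E \<omega> y) ** green x"
    by (simp add: matrix_diff_ldistrib matrix_diff_rdistrib matrix_mul_assoc)
  also have "\<dots> = green y - green x"
    using assms by (simp add: wlaplacian_green green_wlaplacian matrix_diff_ldistrib
        matrix_diff_rdistrib green_mean mean_green)
  finally show ?thesis ..
qed

lemma eventually_simplex_line:
  fixes p v :: "real^'n"
  assumes p: "p \<in> prob_simplex" and v: "v \<in> tangent_simplex"
  shows "\<forall>\<^sub>F t in at 0. p + t *\<^sub>R v \<in> prob_simplex"
proof -
  have "\<forall>\<^sub>F t in at 0. 0 < p $ i + t * v $ i" for i
  proof (rule order_tendstoD)
    show "((\<lambda>t. p $ i + t * v $ i) \<longlongrightarrow> p $ i) (at 0)"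
      by (auto intro!: tendsto_eq_intros)
    show "0 < p $ i"
      using p by (simp add: prob_simplex_def)
  qed
  then have "\<forall>\<^sub>F t in at 0. \<forall>i. 0 < p $ i + t * v $ i"
    by (simp add: eventually_all_finite)
  then show ?thesis
    using p v
    by (auto elim!: eventually_mono simp: prob_simplex_def tangent_simplex_def sum.distrib
        sum_distrib_left[symmetric])
qed

lemma green_line:
  assumes "p \<in> prob_simplex" and "p + t *\<^sub>R v \<in> prob_simplex"
  shows "green (p + t *\<^sub>R v) - green p = - t *\<^sub>R (green (p + t *\<^sub>R v) ** wlaplacian E \<omega> v ** green p)"
    and "green (p + t *\<^sub>R v) - green p = - t *\<^sub>R (green p ** wlaplacian E \<omega> v ** green (p + t *\<^sub>R v))"
proof -
  let ?y = "p + t *\<^sub>R v"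
  have "wlaplacian E \<omega> p - wlaplacian E \<omega> ?y = - t *\<^sub>R wlaplacian E \<omega> v"
    by (simp add: wlaplacian_add_scaleR)
  then show "green ?y - green p = - t *\<^sub>R (green ?y ** wlaplacian E \<omega> v ** green p)"
    by (simp only: green_resolvent[OF assms] matrix_scalar_ac scalar_matrix_assoc)
  have "wlaplacian E \<omega> ?y - wlaplacian E \<omega> p = t *\<^sub>R wlaplacian E \<omega> v"
    by (simp add: wlaplacian_add_scaleR)
  then have "green p - green ?y = t *\<^sub>R (green p ** wlaplacian E \<omega> v ** green ?y)"
    by (simp only: green_resolvent[OF assms(2,1)] matrix_scalar_ac scalar_matrix_assoc)
  then show "green ?y - green p = - t *\<^sub>R (green p ** wlaplacian E \<omega> v ** green ?y)"
    by (metis minus_diff_eq scaleR_minus_left)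
qed

text \<open>
  With \<open>A = L(p)\<^sup>\<dagger> L(v)\<close> the resolvent identity reads \<open>\<psi>\<^sub>t - \<psi>\<^sub>0 = - t A \<psi>\<^sub>t\<close> for
  \<open>\<psi>\<^sub>t = L(p + t v)\<^sup>\<dagger> b\<close>. It bounds \<open>\<psi>\<^sub>t\<close> by itself: once \<open>\<bar>t\<bar> \<parallel>A\<parallel>\<close> is at most one half,
  \<open>\<parallel>\<psi>\<^sub>t\<parallel> \<le> 2 \<parallel>\<psi>\<^sub>0\<parallel>\<close>, and then the same identity shows that the difference is \<open>O(t)\<close>.
\<close>

lemma tendsto_green_line:
  assumes p: "p \<in> prob_simplex" and v: "v \<in> tangent_simplex"
  shows "((\<lambda>t. green (p + t *\<^sub>R v) *v b) \<longlongrightarrow> green p *v b) (at 0)"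
proof -
  define A where "A = green p ** wlaplacian E \<omega> v"
  let ?\<psi> = "\<lambda>t. green (p + t *\<^sub>R v) *v b"
  obtain K where K: "K > 0" "\<And>x. norm (A *v x) \<le> norm x * K"
    using bounded_linear.pos_bounded[OF matrix_vector_mul_bounded_linear[of A]] by auto
  have "\<forall>\<^sub>F t in at 0. \<bar>t\<bar> < 1 / (2 * K)"
    using K(1) by (intro order_tendstoD(2)[of _ 0]) (auto intro!: tendsto_eq_intros)
  then have "\<forall>\<^sub>F t in at 0. norm (?\<psi> t - green p *v b) \<le> \<bar>t\<bar> * (2 * norm (green p *v b) * K)"
    using eventually_simplex_line[OF p v]
  proof eventually_elim
    case (elim t)
    have "?\<psi> t - green p *v b = - t *\<^sub>R (A *v ?\<psi> t)"
      using green_line(2)[OF p elim(2)]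
      by (simp add: A_def matrix_vector_mult_diff_rdistrib[symmetric] matrix_vector_mul_assoc
          scaleR_matrix_vector_assoc)
    then have diff: "norm (?\<psi> t - green p *v b) \<le> \<bar>t\<bar> * (norm (?\<psi> t) * K)"
      using mult_left_mono[OF K(2)[of "?\<psi> t"], of "\<bar>t\<bar>"] by simp
    also have "\<dots> = (\<bar>t\<bar> * K) * norm (?\<psi> t)"
      by simp
    also have "\<dots> \<le> (1/2) * norm (?\<psi> t)"
      using elim(1) K(1) by (intro mult_right_mono) (simp_all add: field_simps)
    finally have "norm (?\<psi> t) \<le> 2 * norm (green p *v b)"
      using norm_triangle_ineq2[of "?\<psi> t" "green p *v b"] by simp
    then have "\<bar>t\<bar> * (norm (?\<psi> t) * K) \<le> \<bar>t\<bar> * (2 * norm (green p *v b) * K)"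
      using K(1) by (intro mult_left_mono mult_right_mono) auto
    with diff show ?case
      by linarith
  qed
  moreover have "((\<lambda>t. \<bar>t\<bar> * (2 * norm (green p *v b) * K)) \<longlongrightarrow> 0) (at 0)"
    by (auto intro!: tendsto_eq_intros)
  ultimately have "((\<lambda>t. ?\<psi> t - green p *v b) \<longlongrightarrow> 0) (at 0)"
    by (rule Lim_null_comparison)
  then show ?thesis
    by (simp add: LIM_zero_cancel)
qed

text \<open>
  By the resolvent identity the difference quotient is, exactly, minus the pairing of
  \<open>L(p + t v)\<^sup>\<dagger> b\<close> with the fixed vector \<open>L(v) L(p)\<^sup>\<dagger> c\<close>, so continuity of the pseudo-inverse along
  the line is enough.
\<close>

lemma dir_deriv_wasserstein_metric:
  assumes p: "p \<in> prob_simplex" and v: "v \<in> tangent_simplex"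
  shows "dir_deriv (\<lambda>x. wasserstein_metric E \<omega> x b c) p v
    = - ((green p *v b) \<bullet> (wlaplacian E \<omega> v *v (green p *v c)))"
proof -
  let ?G = "\<lambda>t. green (p + t *\<^sub>R v)" and ?w = "wlaplacian E \<omega> v *v (green p *v c)"
  have "((\<lambda>t. b \<bullet> (?G t *v c)) has_real_derivative - ((green p *v b) \<bullet> ?w)) (at 0)"
    unfolding DERIV_def
  proof (rule Lim_transform_eventually)
    show "((\<lambda>t. - ((?G t *v b) \<bullet> ?w)) \<longlongrightarrow> - ((green p *v b) \<bullet> ?w)) (at 0)"
      by (intro tendsto_intros tendsto_green_line p v)
    show "\<forall>\<^sub>F t in at 0. - ((?G t *v b) \<bullet> ?w) = (b \<bullet> (?G (0 + t) *v c) - b \<bullet> (?G 0 *v c)) / t"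
      using eventually_simplex_line[OF p v] eventually_neq_at_within[of 0 0 UNIV]
    proof eventually_elim
      case (elim t)
      have "b \<bullet> (?G t *v c) - b \<bullet> (green p *v c) = b \<bullet> ((?G t - green p) *v c)"
        by (simp add: matrix_vector_mult_diff_rdistrib inner_diff_right)
      also have "\<dots> = b \<bullet> ((- t) *\<^sub>R (?G t *v ?w))"
        by (simp only: green_line(1)[OF p elim(1)] scaleR_matrix_vector_assoc
            matrix_vector_mul_assoc matrix_mul_assoc scalar_matrix_assoc)
      also have "\<dots> = - t * (b \<bullet> (?G t *v ?w))"
        by simp
      also have "b \<bullet> (?G t *v ?w) = (?G t *v b) \<bullet> ?w"
        unfolding green_symmetric[OF elim(1), of b] by (rule inner_commute)
      finally show ?case
        using elim(2) by simp
    qed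
  qed
  then show ?thesis
    unfolding dir_deriv_def wasserstein_metric_def
    by (intro vector_derivative_at) (simp add: has_real_derivative_iff_has_vector_derivative)
qed

end

section \<open>The Koszul formula for constant fields\<close>

lemma const_vector_field:
  assumes "v \<in> T" shows "(\<lambda>_. v) \<in> vector_fields M T"
proof -
  have "C_on m M T (\<lambda>_. w)" for m and w :: 'a
    by (induction m arbitrary: w) (simp_all add: dir_deriv_def)
  with assms show ?thesis
    by (simp add: vector_fields_def smooth_on_def)
qed

text \<open>
  The usual alternating sum of three compatibility equations; the bracket terms are absent because
  constant fields commute.
\<close>

lemma koszul_constant_fields:
  assumes lc: "levi_civita_connection M T g nabla"
    and p: "p \<in> M" and T: "a \<in> T" "b \<in> T" "c \<in> T"
    and gsym: "\<And>u v. g p u v = g p v u"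
  shows "2 * g p (nabla (\<lambda>_. a) (\<lambda>_. b) p) c =
    dir_deriv (\<lambda>x. g x b c) p a + dir_deriv (\<lambda>x. g x a c) p b - dir_deriv (\<lambda>x. g x a b) p c"
proof -
  note VF = const_vector_field[of _ T M]
  have comm: "nabla (\<lambda>_. u) (\<lambda>_. v) p = nabla (\<lambda>_. v) (\<lambda>_. u) p" if "u \<in> T" "v \<in> T" for u v
  proof -
    have "nabla (\<lambda>_. u) (\<lambda>_. v) p - nabla (\<lambda>_. v) (\<lambda>_. u) p = lie_bracket (\<lambda>_. u) (\<lambda>_. v) p"
      using lc VF that p unfolding levi_civita_connection_def torsion_free_def by blast
    then show ?thesis
      by (simp add: lie_bracket_def dir_deriv_def)
  qed
  have compat: "dir_deriv (\<lambda>x. g x v w) p u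
      = g p (nabla (\<lambda>_. u) (\<lambda>_. v) p) w + g p v (nabla (\<lambda>_. u) (\<lambda>_. w) p)"
    if "u \<in> T" "v \<in> T" "w \<in> T" for u v w
    using lc VF that p unfolding levi_civita_connection_def metric_compatible_def by fast
  show ?thesis
    using compat[of a b c] compat[of b a c] compat[of c a b] comm[of a b] comm[of a c] comm[of b c]
      gsym T by simp
qed

lemma nabla_constant_fields_tangent:
  assumes "levi_civita_connection M T g nabla" and "p \<in> M" and "a \<in> T" and "b \<in> T"
  shows "nabla (\<lambda>_. a) (\<lambda>_. b) p \<in> T"
proof -
  have "nabla (\<lambda>_. a) (\<lambda>_. b) \<in> vector_fields M T"
    using assms(1) const_vector_field[OF assms(3), of M] const_vector_field[OF assms(4), of M]
    unfolding levi_civita_connection_def affine_connection_def by blast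
  with assms(2) show ?thesis
    by (simp add: vector_fields_def)
qed

text \<open>
  Testing against \<open>c = L(\<rho>) w\<close> undoes the pseudo-inverse: \<open>P c\<close> differs from \<open>w\<close> by a constant
  only, which neither a tangent vector nor any Laplacian sees.
\<close>

lemma wasserstein_connection_eq:
  fixes E :: "('n::finite \<times> 'n) set"
  assumes graph: "connected_weighted_graph E \<omega>"
    and lc: "levi_civita_connection prob_simplex tangent_simplex (wasserstein_metric E \<omega>) nabla"
    and \<rho>: "\<rho> \<in> prob_simplex" and a: "a \<in> tangent_simplex" and b: "b \<in> tangent_simplex"
  defines "L \<equiv> wlaplacian E \<omega>"
  defines "\<phi> \<equiv> pinv (L \<rho>) *v a" and "\<psi> \<equiv> pinv (L \<rho>) *v b"
  shows "2 *\<^sub>R nabla (\<lambda>_. a) (\<lambda>_. b) \<rho>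
    = L \<rho> *v carre_du_champ \<omega> \<phi> \<psi> - L a *v \<psi> - L b *v \<phi>"
proof -
  let ?u = "nabla (\<lambda>_. a) (\<lambda>_. b) \<rho>" and ?P = "pinv (L \<rho>)"
  have u: "?u \<in> tangent_simplex"
    using nabla_constant_fields_tangent[OF lc \<rho> a b] .
  have "2 * (?u \<bullet> w) = (L \<rho> *v carre_du_champ \<omega> \<phi> \<psi> - L a *v \<psi> - L b *v \<phi>) \<bullet> w" for w :: "real^'n"
  proof -
    define c where "c = L \<rho> *v w"
    have c: "c \<in> tangent_simplex"
      unfolding c_def L_def by (rule wlaplacian_tangent[OF graph])
    have Pc: "?P *v c = w - mean_matrix *v w"
      using green_wlaplacian[OF graph \<rho>]
      by (simp add: c_def L_def matrix_vector_mul_assoc matrix_vector_mult_diff_rdistrib)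
    have "?u \<bullet> (mean_matrix *v w) = 0"
      using u by (simp add: mean_matrix_mult_vec inner_vec_def tangent_simplex_def
          sum_distrib_right[symmetric] sum_divide_distrib[symmetric])
    then have uw: "?u \<bullet> w = wasserstein_metric E \<omega> \<rho> ?u c"
      using Pc by (simp add: wasserstein_metric_def L_def inner_diff_right)
    have "L x *v (mean_matrix *v w) = 0" for x
      unfolding L_def mean_matrix_mult_vec by (rule wlaplacian_mult_const[OF graph])
    then have LPc: "L x *v (?P *v c) = L x *v w" for x
      by (simp add: Pc matrix_vector_mult_diff_distrib)
    have gsym: "wasserstein_metric E \<omega> \<rho> x y = wasserstein_metric E \<omega> \<rho> y x" for x y
      unfolding wasserstein_metric_def by (rule green_symmetric[OF graph \<rho>])
    have "2 * (?u \<bullet> w) = - (\<psi> \<bullet> (L a *v w)) - \<phi> \<bullet> (L b *v w) + \<phi> \<bullet> (L c *v \<psi>)"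
      unfolding uw koszul_constant_fields[OF lc \<rho> a b c gsym]
      using dir_deriv_wasserstein_metric[OF graph \<rho>] a b c LPc
      by (simp add: \<phi>_def \<psi>_def L_def)
    also have "\<phi> \<bullet> (L c *v \<psi>) = c \<bullet> carre_du_champ \<omega> \<phi> \<psi>"
      unfolding L_def by (rule inner_wlaplacian_eq_carre_du_champ[OF graph])
    also have "c \<bullet> carre_du_champ \<omega> \<phi> \<psi> = (L \<rho> *v carre_du_champ \<omega> \<phi> \<psi>) \<bullet> w"
      unfolding c_def L_def by (metis inner_commute inner_wlaplacian_commute[OF graph])
    also have "\<psi> \<bullet> (L a *v w) = (L a *v \<psi>) \<bullet> w"
      unfolding L_def by (metis inner_commute inner_wlaplacian_commute[OF graph])
    also have "\<phi> \<bullet> (L b *v w) = (L b *v \<phi>) \<bullet> w"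
      unfolding L_def by (metis inner_commute inner_wlaplacian_commute[OF graph])
    finally show ?thesis
      by (simp add: inner_diff_left)
  qed
  then show ?thesis
    by (intro vector_eq_rdot[THEN iffD1]) simp
qed

section \<open>Contraction of the Christoffel symbols\<close>

lemma sum_kronecker: "(\<Sum>j\<in>UNIV. kronecker j k * x $ j) = x $ (k::'n::finite)"
  by (simp add: kronecker_def if_distrib[of "\<lambda>z. z * _"] cong: if_cong)

text \<open>
  Contraction with \<open>a\<close> and \<open>b\<close> is a linear functional \<open>S\<close> on the coefficients, which factorises on
  products \<open>f i * g j\<close>; each term of the Christoffel symbol is a combination of such products.
\<close>

lemma sum_christoffel_W:
  fixes E :: "('n::finite \<times> 'n) set" and a b \<rho> :: "real^'n"
  assumes graph: "connected_weighted_graph E \<omega>"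
  defines "L \<equiv> wlaplacian E \<omega>"
  defines "\<phi> \<equiv> pinv (L \<rho>) *v a" and "\<psi> \<equiv> pinv (L \<rho>) *v b"
  shows "(\<Sum>i\<in>UNIV. \<Sum>j\<in>UNIV. christoffel_W E \<omega> \<rho> k i j * a $ i * b $ j)
    = (L \<rho> *v carre_du_champ \<omega> \<phi> \<psi> - L a *v \<psi> - L b *v \<phi>) $ k / 2"
proof -
  define P where "P = pinv (L \<rho>)"
  define S where "S f = (\<Sum>i\<in>UNIV. \<Sum>j\<in>UNIV. f i j * a $ i * b $ j)" for f :: "'n \<Rightarrow> 'n \<Rightarrow> real"
  have S_add: "S (\<lambda>i j. f i j + g i j) = S f + S g"
    and S_diff: "S (\<lambda>i j. f i j - g i j) = S f - S g"
    and S_minus: "S (\<lambda>i j. - f i j) = - S f"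
    and S_mult: "S (\<lambda>i j. r * f i j) = r * S f" for f g r
    by (simp_all add: S_def sum.distrib sum_subtractf sum_negf sum_distrib_left algebra_simps)
  have S_sum: "S (\<lambda>i j. \<Sum>l\<in>A. F l i j) = (\<Sum>l\<in>A. S (F l))" for A and F :: "'n \<Rightarrow> 'n \<Rightarrow> 'n \<Rightarrow> real"
    by (induction A rule: infinite_finite_induct) (simp_all add: S_add, simp_all add: S_def)
  have S_prod: "S (\<lambda>i j. f i * g j) = (\<Sum>i\<in>UNIV. f i * a $ i) * (\<Sum>j\<in>UNIV. g j * b $ j)" for f g
    by (simp add: S_def sum_product mult_ac)
  have P_a: "(\<Sum>i\<in>UNIV. (P $ l $ i - P $ m $ i) * a $ i) = \<phi> $ l - \<phi> $ m" for l m
    by (simp add: \<phi>_def P_def matrix_vector_mult_def left_diff_distrib sum_subtractf)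
  have P_b: "(\<Sum>i\<in>UNIV. (P $ l $ i - P $ m $ i) * b $ i) = \<psi> $ l - \<psi> $ m" for l m
    by (simp add: \<psi>_def P_def matrix_vector_mult_def left_diff_distrib sum_subtractf)
  have \<delta>: "(\<Sum>j\<in>UNIV. (kronecker j l + kronecker j m) * x $ j) = 2 * \<theta> x l m" for l m and x :: "real^'n"
    by (simp add: distrib_right sum.distrib sum_kronecker \<theta>_def)
  have S1: "S (\<lambda>i j. (P $ l $ i - P $ m $ i) * (kronecker j l + kronecker j m))
      = 2 * \<theta> b l m * (\<phi> $ l - \<phi> $ m)" for l m
    unfolding S_prod P_a \<delta> by simp
  have S2: "S (\<lambda>i j. (P $ l $ j - P $ m $ j) * (kronecker i l + kronecker i m))
      = 2 * \<theta> a l m * (\<psi> $ l - \<psi> $ m)" for l m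
    using S_prod[of "\<lambda>i. kronecker i l + kronecker i m" "\<lambda>j. P $ l $ j - P $ m $ j"]
    unfolding P_b \<delta> by (simp add: mult.commute)
  have S3: "(\<Sum>m\<in>neighbours E l.
        S (\<lambda>i j. \<omega> l m * (P $ l $ i - P $ m $ i) * (P $ l $ j - P $ m $ j)))
      = 2 * carre_du_champ \<omega> \<phi> \<psi> $ l" for l
    unfolding mult.assoc S_mult S_prod P_a P_b carre_du_champ_def
    by (simp add: sum_neighbours[OF graph])
  have christoffel: "christoffel_W E \<omega> \<rho> k = (\<lambda>i j. 1/4 * (\<Sum>m\<in>neighbours E k. \<omega> k m *
       (- ((P $ k $ i - P $ m $ i) * (kronecker j k + kronecker j m))
         - (P $ k $ j - P $ m $ j) * (kronecker i k + kronecker i m)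
         + \<theta> \<rho> k m * (\<Sum>l\<in>neighbours E k.
             \<omega> k l * (P $ k $ i - P $ l $ i) * (P $ k $ j - P $ l $ j))
         - \<theta> \<rho> k m * (\<Sum>l\<in>neighbours E m.
             \<omega> m l * (P $ m $ i - P $ l $ i) * (P $ m $ j - P $ l $ j)))))"
    by (intro ext) (simp only: christoffel_W_def Let_def P_def L_def mult_minus_left)
  have "(\<Sum>i\<in>UNIV. \<Sum>j\<in>UNIV. christoffel_W E \<omega> \<rho> k i j * a $ i * b $ j)
      = S (christoffel_W E \<omega> \<rho> k)"
    by (simp add: S_def)
  also have "\<dots> = 1/4 * (\<Sum>m\<in>UNIV. \<omega> k m *
       (- (2 * \<theta> b k m * (\<phi> $ k - \<phi> $ m)) - 2 * \<theta> a k m * (\<psi> $ k - \<psi> $ m)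
         + \<theta> \<rho> k m * (2 * carre_du_champ \<omega> \<phi> \<psi> $ k) - \<theta> \<rho> k m * (2 * carre_du_champ \<omega> \<phi> \<psi> $ m)))"
    by (simp only: christoffel S_mult S_sum S_add S_diff S_minus S1 S2 S3 sum_neighbours[OF graph])
  also have "\<dots> = (L \<rho> *v carre_du_champ \<omega> \<phi> \<psi> - L a *v \<psi> - L b *v \<phi>) $ k / 2"
    unfolding vector_minus_component L_def wlaplacian_nth[OF graph] sum_subtractf[symmetric]
      sum_distrib_left sum_divide_distrib
    by (intro sum.cong refl) (simp add: field_simps)
  finally show ?thesis .
qed

theorem proposition4:
  fixes E :: "('n::finite \<times> 'n) set"
    and \<omega> :: "'n \<Rightarrow> 'n \<Rightarrow> real"
    and nabla :: "(real^'n \<Rightarrow> real^'n) \<Rightarrow> (real^'n \<Rightarrow> real^'n) \<Rightarrow> real^'n \<Rightarrow> real^'n"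
    and \<rho> \<sigma>1 \<sigma>2 :: "real^'n"
    and k :: 'n
  assumes "connected_weighted_graph E \<omega>"
    and "levi_civita_connection prob_simplex tangent_simplex (wasserstein_metric E \<omega>) nabla"
    and "\<rho> \<in> prob_simplex"
    and "\<sigma>1 \<in> tangent_simplex"
    and "\<sigma>2 \<in> tangent_simplex"
  shows "(\<Sum>i\<in>UNIV. \<Sum>j\<in>UNIV. christoffel_W E \<omega> \<rho> k i j * \<sigma>1 $ i * \<sigma>2 $ j)
       = nabla (\<lambda>_. \<sigma>1) (\<lambda>_. \<sigma>2) \<rho> $ k"
  unfolding sum_christoffel_W[OF assms(1)] wasserstein_connection_eq[OF assms, symmetric]
  by simp

end
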